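(* Let $n,d$ be positive integers with $d\ge 2$ and $n\ge 2d+2$. If $\mathcal{F}\subseteq\binom{[n]}{d+1}$ is a set system with VC-dimension at most $d$, then $|\mathcal{F}|<\binom{n}{d}$.
   Context: Here $[n]=\{1,2,\ldots,n\}$ and $\binom{[n]}{k}$ denotes the family of all subsets of $[n]$ of size $k$. The VC-dimension of a set system $\mathcal{F}\subseteq 2^V$ on a ground set $V$ is the largest size of a subset $S\subseteq V$ such that for every subset $S'\subseteq S$ there exists a member $F_{S'}\in\mathcal{F}$ with $F_{S'}\cap S=S'$. Thus VC-dimension at most $d$ means that no set $S\subseteq V$ with $|S|>d$ has this property. *)

theory Defs
  imports Complex_Main "HOL-Library.Extended_Nat"
begin

definition shatters :: "'a set set \<Rightarrow> 'a set \<Rightarrow> bool" where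
  "shatters F S \<longleftrightarrow> (\<forall>S'\<subseteq>S. \<exists>A\<in>F. A \<inter> S = S')"

text \<open>The largest size of a shattered subset of the ground set \<open>V\<close>, and infinity if there are
  arbitrarily large finite ones. The empty family shatters no set; the supremum over the empty
  set gives it dimension 0.\<close>

definition vc_dim :: "'a set \<Rightarrow> 'a set set \<Rightarrow> enat" where
  "vc_dim V F = (SUP S\<in>{S. S \<subseteq> V \<and> finite S \<and> shatters F S}. enat (card S))"

lemma vc_dim_le_iff:
  assumes "finite V"
  shows "vc_dim V F \<le> enat d \<longleftrightarrow> \<not> (\<exists>S\<subseteq>V. card S > d \<and> shatters F S)"
  using assms by (auto simp: vc_dim_def SUP_le_iff not_less dest: finite_subset)

end

theory Submission
  imports Defs
begin

text \<open>
  Call \<open>B \<subseteq> A\<close> a missing trace of \<open>A\<close> if no member of \<open>F\<close> meets \<open>A\<close> in exactly \<open>B\<close>. Since no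
  \<open>(d+1)\<close>-set is shattered, every \<open>A \<in> F\<close> has a missing trace. Suppose that
  \<open>card F \<ge> n choose d\<close>.

  Let \<open>S\<close> be a \<open>(d+1)\<close>-set outside \<open>F\<close>. The family \<open>insert S F\<close> has more members than there are
  \<open>d\<close>-sets, so there are weights \<open>\<alpha>\<close>, not all zero on it, such that for every set \<open>T\<close> with at
  most \<open>d\<close> elements the weights of the members above \<open>T\<close> sum to zero. By inclusion-exclusion, for
  each member \<open>A\<close> and each proper subset \<open>B\<close> of \<open>A\<close>, the weights of the members whose trace on
  \<open>A\<close> is \<open>B\<close> sum to \<open>\<alpha> A\<close> up to sign. If \<open>A \<in> F\<close> and \<open>B\<close> is a missing trace of \<open>A\<close>, only \<open>S\<close>
  can have this trace; hence \<open>\<alpha> S \<noteq> 0\<close>, and \<open>\<alpha> A \<noteq> 0\<close> holds exactly when \<open>S \<inter> A = B\<close>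
  (lemma \<open>weights_nonmember\<close>). Two consequences follow; a facet of a \<open>(d+1)\<close>-set is a
  \<open>d\<close>-subset of it.

  \<^item> If a \<open>d\<close>-set \<open>T\<close> lies in a \<open>(d+1)\<close>-set outside \<open>F\<close>, then exactly one member of \<open>F\<close> contains
    \<open>T\<close>, and \<open>T\<close> is a missing trace of it (lemma \<open>facet_of_nonmember\<close>).
  \<^item> A member of \<open>F\<close> has at most one missing trace with \<open>d\<close> elements
    (lemma \<open>missing_facet_unique\<close>).

  If \<open>S\<close> is outside \<open>F\<close>, then one of its facets is completed by some \<open>a\<close>, the apex, to a
  member of \<open>F\<close>. The two facts force all its facets to be completed by this same \<open>a\<close> and by no
  other element, so the exchange of an element of \<open>S\<close> for another one different from \<open>a\<close> leads
  again to a set outside \<open>F\<close> with the same \<open>a\<close>. By such exchanges one reaches all \<open>(d+1)\<close>-sets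
  avoiding \<open>a\<close>. Hence all members of \<open>F\<close> contain \<open>a\<close>, and \<open>card F \<le> (n - 1) choose d\<close>, which
  is less than \<open>n choose d\<close>. If no \<open>S\<close> is outside \<open>F\<close>, then \<open>F\<close> consists of all \<open>(d+1)\<close>-sets
  and shatters each of them, because \<open>n \<ge> 2 * d + 2\<close>.
\<close>

section \<open>Linear dependencies between set incidences\<close>

lemma homogeneous_system_nontrivial_solution:
  fixes m :: "'j \<Rightarrow> 'i \<Rightarrow> 'k::field"
  assumes "finite J" and "finite I" and "card J < card I"
  shows "\<exists>x. (\<exists>i\<in>I. x i \<noteq> 0) \<and> (\<forall>j\<in>J. (\<Sum>i\<in>I. x i * m j i) = 0)"
  using assms
proof (induction J arbitrary: I m rule: finite_induct)
  case empty
  then have "I \<noteq> {}" by auto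
  then show ?case by (intro exI[of _ "\<lambda>_. 1"]) auto
next
  case (insert j0 J)
  show ?case
  proof (cases "\<forall>i\<in>I. m j0 i = 0")
    case True
    have "card J < card I" using insert by simp
    then obtain x where "\<exists>i\<in>I. x i \<noteq> 0" "\<forall>j\<in>J. (\<Sum>i\<in>I. x i * m j i) = 0"
      using insert.IH[of I m] insert.prems by blast
    then show ?thesis using True by (intro exI[of _ x]) auto
  next
    case False
    then obtain i0 where i0: "i0 \<in> I" "m j0 i0 \<noteq> 0" by blast
    define I' where "I' = I - {i0}"
    have fin: "finite I'" using insert.prems by (simp add: I'_def)
    have card: "card J < card I'"
      using insert.hyps insert.prems i0 by (simp add: I'_def)
    obtain x where x: "\<exists>i\<in>I'. x i \<noteq> 0"
      and sol: "\<And>j. j \<in> J \<Longrightarrow> (\<Sum>i\<in>I'. x i * (m j i - m j i0 * m j0 i / m j0 i0)) = 0"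
      using insert.IH[OF fin card, of "\<lambda>j i. m j i - m j i0 * m j0 i / m j0 i0"] by blast
    define s where "s = (\<Sum>i\<in>I'. x i * m j0 i) / m j0 i0"
    define y where "y = x(i0 := - s)"
    have split: "(\<Sum>i\<in>I. y i * m j i) = - s * m j i0 + (\<Sum>i\<in>I'. x i * m j i)" for j
    proof -
      have "(\<Sum>i\<in>I. y i * m j i) = y i0 * m j i0 + (\<Sum>i\<in>I'. y i * m j i)"
        unfolding I'_def using i0 insert.prems by (simp add: sum.remove)
      also have "(\<Sum>i\<in>I'. y i * m j i) = (\<Sum>i\<in>I'. x i * m j i)"
        by (rule sum.cong) (auto simp: y_def I'_def)
      finally show ?thesis by (simp add: y_def)
    qed
    have "(\<Sum>i\<in>I. y i * m j i) = 0" if "j \<in> insert j0 J" for j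
    proof (cases "j = j0")
      case True
      then show ?thesis using i0 by (simp add: split s_def)
    next
      case False
      with that have "j \<in> J" by simp
      have "0 = (\<Sum>i\<in>I'. x i * m j i - m j i0 / m j0 i0 * (x i * m j0 i))"
        using sol[OF \<open>j \<in> J\<close>] by (simp add: algebra_simps)
      also have "\<dots> = (\<Sum>i\<in>I'. x i * m j i) - m j i0 / m j0 i0 * (\<Sum>i\<in>I'. x i * m j0 i)"
        by (simp add: sum_subtractf sum_distrib_left)
      finally show ?thesis by (simp add: split s_def)
    qed
    moreover have "\<exists>i\<in>I. y i \<noteq> 0"
      using x by (auto simp: y_def I'_def)
    ultimately show ?thesis by blast
  qed
qed

text \<open>In a uniform family, a dependency over the sets of size \<open>d\<close> descends to all smaller sets.\<close>

lemma sum_supersets_zero_if_card_le: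
  fixes \<alpha> :: "'a set \<Rightarrow> real"
  assumes V: "finite V" and G: "G \<subseteq> {A. A \<subseteq> V \<and> card A = d + 1}"
    and top: "\<And>T. T \<subseteq> V \<Longrightarrow> card T = d \<Longrightarrow> (\<Sum>A\<in>{A\<in>G. T \<subseteq> A}. \<alpha> A) = 0"
    and T: "T \<subseteq> V" "card T \<le> d"
  shows "(\<Sum>A\<in>{A\<in>G. T \<subseteq> A}. \<alpha> A) = 0"
  using T
proof (induction "d - card T" arbitrary: T)
  case 0
  then show ?case using top by simp
next
  case (Suc k)
  have finG: "finite G"
    by (rule finite_subset[of G "Pow V"]) (use G V in auto)
  have finT: "finite T" using Suc.prems V finite_subset by blast
  \<comment> \<open>Each member above \<open>T\<close> is counted once for each of its \<open>d + 1 - card T\<close> elements outside \<open>T\<close>.\<close>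
  have "(\<Sum>x\<in>V - T. \<Sum>A\<in>{A\<in>G. insert x T \<subseteq> A}. \<alpha> A) = 0"
  proof (rule sum.neutral, rule ballI)
    fix x assume "x \<in> V - T"
    then show "(\<Sum>A\<in>{A\<in>G. insert x T \<subseteq> A}. \<alpha> A) = 0"
      using Suc finT by (intro Suc.hyps(1)) auto
  qed
  also have "(\<Sum>x\<in>V - T. \<Sum>A\<in>{A\<in>G. insert x T \<subseteq> A}. \<alpha> A)
      = (\<Sum>A\<in>G. \<Sum>x\<in>{x\<in>V - T. insert x T \<subseteq> A}. \<alpha> A)"
    using V finG by (intro sum.swap_restrict) auto
  also have "\<dots> = (\<Sum>A\<in>G. if T \<subseteq> A then real (d + 1 - card T) * \<alpha> A else 0)"
  proof (rule sum.cong[OF refl])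
    fix A assume "A \<in> G"
    then have A: "A \<subseteq> V" "card A = d + 1" using G by auto
    show "(\<Sum>x\<in>{x\<in>V - T. insert x T \<subseteq> A}. \<alpha> A)
        = (if T \<subseteq> A then real (d + 1 - card T) * \<alpha> A else 0)"
    proof (cases "T \<subseteq> A")
      case True
      then have "{x\<in>V - T. insert x T \<subseteq> A} = A - T" using A by auto
      then show ?thesis using True A finT by (simp add: card_Diff_subset)
    qed simp
  qed
  also have "\<dots> = real (d + 1 - card T) * (\<Sum>A\<in>{A\<in>G. T \<subseteq> A}. \<alpha> A)"
    using finG by (simp add: sum.If_cases sum_distrib_left Int_def conj_commute)
  finally show ?case using Suc.prems by simp
qed

lemma exists_dependency:
  fixes V :: "'a set"
  assumes V: "finite V" and G: "G \<subseteq> {A. A \<subseteq> V \<and> card A = d + 1}"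
    and card: "card V choose d < card G"
  shows "\<exists>\<alpha> :: 'a set \<Rightarrow> real. (\<exists>A\<in>G. \<alpha> A \<noteq> 0)
    \<and> (\<forall>T\<subseteq>V. card T \<le> d \<longrightarrow> (\<Sum>A\<in>{A\<in>G. T \<subseteq> A}. \<alpha> A) = 0)"
proof -
  define J where "J = {T. T \<subseteq> V \<and> card T = d}"
  have finG: "finite G" using card card.infinite by fastforce
  have finJ: "finite J" unfolding J_def using V by simp
  have "card J < card G" using card n_subsets[OF V, of d] by (simp add: J_def)
  then obtain \<alpha> :: "'a set \<Rightarrow> real" where nz: "\<exists>A\<in>G. \<alpha> A \<noteq> 0"
    and sol: "\<forall>T\<in>J. (\<Sum>A\<in>G. \<alpha> A * (if T \<subseteq> A then 1 else 0)) = 0"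
    using homogeneous_system_nontrivial_solution[OF finJ finG, of "\<lambda>T A. if T \<subseteq> A then 1 else 0"]
    by blast
  have "(\<Sum>A\<in>{A\<in>G. T \<subseteq> A}. \<alpha> A) = 0" if "T \<subseteq> V" "card T = d" for T
  proof -
    have "(\<Sum>A\<in>{A\<in>G. T \<subseteq> A}. \<alpha> A) = (\<Sum>A\<in>G. \<alpha> A * (if T \<subseteq> A then 1 else 0))"
      using finG by (simp add: sum.If_cases Int_def if_distrib conj_commute cong: if_cong)
    then show ?thesis using sol that by (simp add: J_def)
  qed
  then show ?thesis
    using nz sum_supersets_zero_if_card_le[OF V G] by blast
qed

text \<open>Inclusion-exclusion, where \<open>D\<close> is the set of elements that are prescribed to be absent.\<close>

lemma sum_avoiding:
  fixes \<alpha> :: "'a set \<Rightarrow> real"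
  assumes "finite G" and "finite A"
    and above: "\<And>B. B \<subseteq> A \<Longrightarrow> (\<Sum>A'\<in>{A'\<in>G. B \<subseteq> A'}. \<alpha> A') = (if B = A then \<alpha> A else 0)"
    and "D \<subseteq> A" and "B \<subseteq> A" and "B \<inter> D = {}"
  shows "(\<Sum>A'\<in>{A'\<in>G. B \<subseteq> A' \<and> A' \<inter> D = {}}. \<alpha> A')
    = (if B \<union> D = A then (-1) ^ card D * \<alpha> A else 0)"
proof -
  have "finite D" using assms(2,4) finite_subset by blast
  then show ?thesis using assms(4-6)
  proof (induction D arbitrary: B rule: finite_induct)
    case empty
    then show ?case using above[of B] by simp
  next
    case (insert x D)
    let ?W = "\<lambda>B D. {A'\<in>G. B \<subseteq> A' \<and> A' \<inter> D = {}}"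
    have "?W B D = ?W B (insert x D) \<union> ?W (insert x B) D" by auto
    moreover have "?W B (insert x D) \<inter> ?W (insert x B) D = {}" by auto
    ultimately have "sum \<alpha> (?W B D) = sum \<alpha> (?W B (insert x D)) + sum \<alpha> (?W (insert x B) D)"
      using \<open>finite G\<close> by (simp add: sum.union_disjoint)
    moreover have "sum \<alpha> (?W B D) = (if B \<union> D = A then (-1) ^ card D * \<alpha> A else 0)"
      using insert.prems by (intro insert.IH) auto
    moreover have "sum \<alpha> (?W (insert x B) D)
        = (if insert x B \<union> D = A then (-1) ^ card D * \<alpha> A else 0)"
      using insert.hyps insert.prems by (intro insert.IH) auto
    moreover have "B \<union> D \<noteq> A" using insert.hyps insert.prems by auto
    moreover have "insert x B \<union> D = B \<union> insert x D" by simp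
    ultimately show ?case using insert.hyps
      by (simp add: add_eq_0_iff split: if_splits)
  qed
qed

lemma sum_trace:
  fixes \<alpha> :: "'a set \<Rightarrow> real"
  assumes "finite G" and "finite A"
    and "\<And>B. B \<subseteq> A \<Longrightarrow> (\<Sum>A'\<in>{A'\<in>G. B \<subseteq> A'}. \<alpha> A') = (if B = A then \<alpha> A else 0)"
    and "B \<subseteq> A"
  shows "(\<Sum>A'\<in>{A'\<in>G. A' \<inter> A = B}. \<alpha> A') = (-1) ^ card (A - B) * \<alpha> A"
proof -
  have "{A'\<in>G. A' \<inter> A = B} = {A'\<in>G. B \<subseteq> A' \<and> A' \<inter> (A - B) = {}}"
    using \<open>B \<subseteq> A\<close> by auto
  moreover have "B \<union> (A - B) = A" using \<open>B \<subseteq> A\<close> by auto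
  ultimately show ?thesis
    using sum_avoiding[OF assms(1-3), of "A - B" B] \<open>B \<subseteq> A\<close> by simp
qed

section \<open>Large uniform families in which no member is shattered\<close>

text \<open>A subset \<open>B\<close> of \<open>A\<close> that witnesses that \<open>F\<close> does not shatter \<open>A\<close>.\<close>

definition missing_trace :: "'a set set \<Rightarrow> 'a set \<Rightarrow> 'a set \<Rightarrow> bool" where
  "missing_trace F A B \<longleftrightarrow> B \<subseteq> A \<and> (\<forall>A'\<in>F. A' \<inter> A \<noteq> B)"

text \<open>The last assumption says that no member of \<open>F\<close> is shattered. Nothing is needed for the
  other sets of size \<open>d + 1\<close>: by uniformity a shattered one is its own trace, hence a member.\<close>

locale large_unshattered_family =
  fixes V :: "'a set" and d :: nat and F :: "'a set set"
  assumes finite_V: "finite V"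
    and uniform: "A \<in> F \<Longrightarrow> A \<subseteq> V \<and> card A = d + 1"
    and large: "card V choose d \<le> card F"
    and ex_missing_trace: "A \<in> F \<Longrightarrow> \<exists>B. missing_trace F A B"
begin

lemma finite_F: "finite F"
  by (rule finite_subset[of F "Pow V"]) (use uniform finite_V in auto)

lemma finite_if_card: "card A = d + 1 \<Longrightarrow> finite A"
  using card.infinite by fastforce

text \<open>A dependency between \<open>S\<close> and the members of \<open>F\<close>, whose support can be read off from any
  choice of missing traces.\<close>

lemma weights_nonmember:
  assumes S: "S \<subseteq> V" "card S = d + 1" "S \<notin> F"
  obtains \<alpha> :: "'a set \<Rightarrow> real" where "\<alpha> S \<noteq> 0"
    and "\<And>T. T \<subseteq> V \<Longrightarrow> card T \<le> d \<Longrightarrow> (\<Sum>A\<in>{A\<in>insert S F. T \<subseteq> A}. \<alpha> A) = 0"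
    and "\<And>A B. A \<in> F \<Longrightarrow> missing_trace F A B \<Longrightarrow> \<alpha> A \<noteq> 0 \<longleftrightarrow> S \<inter> A = B"
proof -
  let ?G = "insert S F"
  have G: "?G \<subseteq> {A. A \<subseteq> V \<and> card A = d + 1}" using S uniform by auto
  have "card V choose d < card ?G" using large S finite_F by simp
  from exists_dependency[OF finite_V G this]
  obtain \<alpha> :: "'a set \<Rightarrow> real" where nz: "\<exists>A\<in>?G. \<alpha> A \<noteq> 0"
    and dep: "\<And>T. T \<subseteq> V \<Longrightarrow> card T \<le> d \<Longrightarrow> (\<Sum>A\<in>{A\<in>?G. T \<subseteq> A}. \<alpha> A) = 0"
    by blast
  have trace: "(if S \<inter> A = B then \<alpha> S else 0) = (-1) ^ card (A - B) * \<alpha> A"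
    if A: "A \<in> F" and B: "missing_trace F A B" for A B
  proof -
    have cA: "A \<subseteq> V" "card A = d + 1" "finite A" using uniform[OF A] finite_if_card by auto
    have above: "(\<Sum>A'\<in>{A'\<in>?G. C \<subseteq> A'}. \<alpha> A') = (if C = A then \<alpha> A else 0)" if "C \<subseteq> A" for C
    proof (cases "C = A")
      case True
      have "A' = A" if "A' \<in> ?G" "A \<subseteq> A'" for A'
        using that G cA card_subset_eq[of A' A] finite_if_card[of A'] by auto
      then have "{A'\<in>?G. C \<subseteq> A'} = {A}" using True A by blast
      then show ?thesis using True by simp
    next
      case False
      then have "card C < card A" using that cA by (intro psubset_card_mono) auto
      then show ?thesis using dep[of C] that cA False by auto
    qed
    have "{A'\<in>?G. A' \<inter> A = B} = (if S \<inter> A = B then {S} else {})"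
      using B by (auto simp: missing_trace_def)
    moreover have "(\<Sum>A'\<in>{A'\<in>?G. A' \<inter> A = B}. \<alpha> A') = (-1) ^ card (A - B) * \<alpha> A"
      using sum_trace[of ?G A \<alpha> B] above B finite_F cA by (auto simp: missing_trace_def)
    ultimately show ?thesis by (simp split: if_splits)
  qed
  have aS: "\<alpha> S \<noteq> 0"
  proof
    assume "\<alpha> S = 0"
    have "\<alpha> A = 0" if A: "A \<in> F" for A
    proof -
      obtain B where B: "missing_trace F A B" using ex_missing_trace[OF A] by blast
      show ?thesis using trace[OF A B] \<open>\<alpha> S = 0\<close> by (simp split: if_splits)
    qed
    then show False using nz \<open>\<alpha> S = 0\<close> by auto
  qed
  show ?thesis
  proof (rule that)
    show "\<alpha> A \<noteq> 0 \<longleftrightarrow> S \<inter> A = B" if "A \<in> F" "missing_trace F A B" for A B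
      using trace[OF that] aS by (auto split: if_splits)
  qed (fact aS dep)+
qed

lemma facet_of_nonmember:
  assumes S: "S \<subseteq> V" "card S = d + 1" "S \<notin> F" and T: "T \<subseteq> S" "card T = d"
  obtains A where "A \<in> F" and "T \<subseteq> A" and "missing_trace F A T"
    and "\<And>A'. A' \<in> F \<Longrightarrow> T \<subseteq> A' \<Longrightarrow> A' = A"
proof -
  obtain \<alpha> :: "'a set \<Rightarrow> real" where aS: "\<alpha> S \<noteq> 0"
    and dep: "\<And>T. T \<subseteq> V \<Longrightarrow> card T \<le> d \<Longrightarrow> (\<Sum>A\<in>{A\<in>insert S F. T \<subseteq> A}. \<alpha> A) = 0"
    and supp: "\<And>A B. A \<in> F \<Longrightarrow> missing_trace F A B \<Longrightarrow> \<alpha> A \<noteq> 0 \<longleftrightarrow> S \<inter> A = B"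
    by (rule weights_nonmember[OF S]) (rule that)
  have "{A\<in>insert S F. T \<subseteq> A} = insert S {A\<in>F. T \<subseteq> A}" using T by auto
  then have "\<alpha> S + (\<Sum>A\<in>{A\<in>F. T \<subseteq> A}. \<alpha> A) = 0"
    using dep[of T] S T finite_F by auto
  then have "(\<Sum>A\<in>{A\<in>F. T \<subseteq> A}. \<alpha> A) \<noteq> 0" using aS by auto
  then obtain A where "A \<in> {A\<in>F. T \<subseteq> A}" "\<alpha> A \<noteq> 0"
    by (rule sum.not_neutral_contains_not_neutral)
  then have A: "A \<in> F" "T \<subseteq> A" "\<alpha> A \<noteq> 0" by auto
  have T_inter: "A1 \<inter> A2 = T"
    if "T \<subseteq> A1" "T \<subseteq> A2" "card A1 = d + 1" "card A2 = d + 1" "A1 \<noteq> A2" for A1 A2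
  proof -
    have fin: "finite A1" "finite A2" using that finite_if_card by auto
    have "A1 \<inter> A2 \<subset> A1"
      using that fin card_subset_eq[of A2 A1] by auto
    then have "card (A1 \<inter> A2) \<le> d" using psubset_card_mono[OF fin(1), of "A1 \<inter> A2"] that by simp
    then show ?thesis using that T fin card_seteq[of "A1 \<inter> A2" T] by auto
  qed
  have "S \<noteq> A" using A S by auto
  then have "S \<inter> A = T" using T_inter[of S A] A T S uniform[of A] by simp
  then have miss: "missing_trace F A T"
    using ex_missing_trace[OF A(1)] supp[OF A(1)] A(3) by auto
  have "A' = A" if "A' \<in> F" "T \<subseteq> A'" for A'
  proof (rule ccontr)
    assume "A' \<noteq> A"
    then have "A' \<inter> A = T"
      using T_inter[of A' A] A(1,2) that uniform[of A] uniform[of A'] by simp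
    then show False using miss that by (simp add: missing_trace_def)
  qed
  then show ?thesis by (rule that[OF A(1,2) miss])
qed

text \<open>The set \<open>S\<close> meets \<open>A\<close> in \<open>T\<close> and is therefore outside \<open>F\<close>. Since \<open>T\<close> is a
  missing trace, the weight of \<open>A\<close> is nonzero; hence every missing trace of \<open>A\<close> equals \<open>S \<inter> A\<close>.\<close>

lemma missing_facet_unique:
  assumes A: "A \<in> F" and T: "missing_trace F A T" "card T = d"
    and T': "missing_trace F A T'" and S: "S \<subseteq> V" "card S = d + 1" "S \<noteq> A" "T \<subseteq> S"
  shows "T' = T"
proof -
  have cA: "card A = d + 1" "finite A" using uniform[OF A] finite_if_card by auto
  have finS: "finite S" using S finite_if_card by auto
  have TA: "T \<subseteq> A" using T by (auto simp: missing_trace_def)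
  have "S \<inter> A \<subset> A" using card_subset_eq[OF finS, of A] S cA by auto
  then have "card (S \<inter> A) \<le> d" using psubset_card_mono[OF cA(2), of "S \<inter> A"] cA by simp
  then have eq: "S \<inter> A = T"
    using card_seteq[of "S \<inter> A" T] TA S finS T by auto
  then have "S \<notin> F" using T by (auto simp: missing_trace_def)
  then obtain \<alpha> :: "'a set \<Rightarrow> real"
    where "\<And>B. missing_trace F A B \<Longrightarrow> \<alpha> A \<noteq> 0 \<longleftrightarrow> S \<inter> A = B"
    using weights_nonmember[OF S(1,2)] A by metis
  then have "S \<inter> A = T'" using T(1) T' eq by blast
  then show ?thesis using eq by simp
qed

text \<open>The element \<open>a\<close> completes every facet of the nonmember \<open>S\<close> as soon as it completes one.\<close>

lemma apex_all_facets:
  assumes S: "S \<subseteq> V" "card S = d + 1" "S \<notin> F" and a: "a \<notin> S"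
    and s: "s \<in> S" "insert a (S - {s}) \<in> F" and t: "t \<in> S"
  shows "insert a (S - {t}) \<in> F"
proof (cases "t = s")
  case False
  define T where "T = S - {s}"
  define A where "A = insert a T"
  have finS: "finite S" using S finite_if_card by auto
  have T: "T \<subseteq> S" "card T = d" using s S finS by (auto simp: T_def)
  have A: "A \<in> F" "a \<in> V" using s uniform[of "insert a (S - {s})"] by (auto simp: A_def T_def)
  have missT: "missing_trace F A T"
    by (rule facet_of_nonmember[OF S T]) (use A(1) A_def in blast)
  define U where "U = A - {t}"
  have tA: "t \<in> A" "t \<noteq> a" using t False a by (auto simp: A_def T_def)
  have U: "U \<subseteq> insert a (S - {t})" "U \<subseteq> A" "card U = d"
    using tA uniform[OF A(1)] finite_if_card[of A] by (auto simp: U_def A_def T_def)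
  have R: "insert a (S - {t}) \<subseteq> V" "card (insert a (S - {t})) = d + 1"
    using A S a t finS by auto
  show ?thesis
  proof (rule ccontr)
    assume "insert a (S - {t}) \<notin> F"
    then have "missing_trace F A U"
      using facet_of_nonmember[OF R _ U(1,3)] A(1) U(2) by metis
    moreover have "S \<noteq> A" using A S by auto
    ultimately have "U = T" using missing_facet_unique[OF A(1) missT T(2), of U S] S T by blast
    moreover have "t \<in> T" "t \<notin> U" using t False by (auto simp: T_def U_def)
    ultimately show False by simp
  qed
qed (use s in simp)

text \<open>The properties of \<open>S\<close> and \<open>a\<close> assumed here are inherited by the exchanged set; the facet
  completed by \<open>a\<close> is now the one opposite to \<open>x\<close>.\<close>

lemma apex_exchange:
  assumes S: "S \<subseteq> V" "card S = d + 1" "S \<notin> F" and a: "a \<notin> S"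
    and s: "s \<in> S" "insert a (S - {s}) \<in> F"
    and t: "t \<in> S" and x: "x \<in> V" "x \<notin> S" "x \<noteq> a"
  shows "insert x (S - {t}) \<notin> F" and "insert a (insert x (S - {t}) - {x}) \<in> F"
proof -
  have finS: "finite S" using S finite_if_card by auto
  have in_F: "insert a (S - {t}) \<in> F" using apex_all_facets[OF S a s t] .
  have "S - {t} \<subseteq> S" "card (S - {t}) = d" using S t finS by auto
  then have "A = insert a (S - {t})" if "A \<in> F" "S - {t} \<subseteq> A" for A
    using facet_of_nonmember[OF S] that in_F by (metis subset_insertI)
  then show "insert x (S - {t}) \<notin> F"
    using x a by blast
  have "insert x (S - {t}) - {x} = S - {t}" using x by auto
  then show "insert a (insert x (S - {t}) - {x}) \<in> F" using in_F by simp
qed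

lemma nonmember_if_avoids_apex:
  assumes R: "R \<subseteq> V" "card R = d + 1" "a \<notin> R"
    and S: "S \<subseteq> V" "card S = d + 1" "S \<notin> F" and a: "a \<notin> S"
    and s: "\<exists>s\<in>S. insert a (S - {s}) \<in> F"
  shows "R \<notin> F"
  using S a s
proof (induction "card (R - S)" arbitrary: S)
  case 0
  have "finite R" "finite S" using R 0 finite_if_card by auto
  then have "R \<subseteq> S" using 0 by auto
  then have "R = S" using 0 R \<open>finite S\<close> by (intro card_subset_eq) auto
  then show ?case using 0 by simp
next
  case (Suc k)
  have fin: "finite R" "finite S" using R Suc finite_if_card by auto
  obtain x where x: "x \<in> R" "x \<notin> S" 
    using Suc.hyps(2) by (cases "R - S = {}") auto
  have "\<not> S \<subseteq> R" using card_subset_eq[OF fin(1), of S] x R Suc.prems by auto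
  then obtain t where t: "t \<in> S" "t \<notin> R" by blast
  obtain s where s: "s \<in> S" "insert a (S - {s}) \<in> F" using Suc.prems by blast
  let ?S' = "insert x (S - {t})"
  have xa: "x \<in> V" "x \<noteq> a" using x R by auto
  have "R - ?S' = R - S - {x}" using t by auto
  then have "k = card (R - ?S')" using Suc.hyps(2) x by simp
  moreover have "?S' \<subseteq> V" "card ?S' = d + 1" "a \<notin> ?S'"
    using Suc.prems xa x t fin by auto
  moreover have "?S' \<notin> F" "insert a (?S' - {x}) \<in> F"
    using apex_exchange[OF Suc.prems(1-4) s t(1) xa(1) x(2) xa(2)] by auto
  ultimately show ?case using Suc.hyps(1)[of ?S'] by blast
qed

lemma nonmember_imp_star:
  assumes S: "S \<subseteq> V" "card S = d + 1" "S \<notin> F"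
  shows "\<exists>a\<in>V. \<forall>A\<in>F. a \<in> A"
proof -
  have finS: "finite S" using S finite_if_card by auto
  have "S \<noteq> {}" using S by auto
  then obtain s where s: "s \<in> S" by blast
  define T where "T = S - {s}"
  have T: "T \<subseteq> S" "card T = d" using s S finS by (auto simp: T_def)
  obtain A where A: "A \<in> F" "T \<subseteq> A" by (rule facet_of_nonmember[OF S T])
  have cA: "card A = d + 1" "A \<subseteq> V" "finite A" using uniform[OF A(1)] finite_if_card by auto
  have "card (A - T) = 1" using A T cA finS by (simp add: card_Diff_subset finite_subset)
  then obtain a where "A - T = {a}" using card_1_singletonE by blast
  then have eq: "A = insert a T" and aT: "a \<notin> T" using A by auto
  have "a \<noteq> s" using eq A S s by (auto simp: T_def insert_absorb)
  then have "a \<notin> S" using aT by (auto simp: T_def)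
  moreover have "\<exists>s\<in>S. insert a (S - {s}) \<in> F" using s A eq T_def by blast
  ultimately have "a \<in> R" if "R \<in> F" for R
    using nonmember_if_avoids_apex[of R a S] that uniform S by blast
  then show ?thesis using eq cA by auto
qed

end

section \<open>Strictness of the bound\<close>

lemma shatters_all_uniform:
  assumes V: "finite V" "2 * k \<le> card V" and A: "A \<subseteq> V" "card A = k"
  shows "shatters {A. A \<subseteq> V \<and> card A = k} A"
  unfolding shatters_def
proof (intro allI impI)
  fix B assume B: "B \<subseteq> A"
  have finA: "finite A" using A V(1) by (simp add: finite_subset)
  have finB: "finite B" using B finA by (rule finite_subset)
  have "card B \<le> k" using card_mono[OF finA B] A by simp
  have "k - card B \<le> card (V - A)" using V A finA by (simp add: card_Diff_subset)
  then obtain C where C: "C \<subseteq> V - A" "card C = k - card B" "finite C"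
    using obtain_subset_with_card_n by metis
  have "card (B \<union> C) = k"
    using C B finB \<open>card B \<le> k\<close> by (subst card_Un_disjoint) auto
  moreover have "(B \<union> C) \<inter> A = B" "B \<union> C \<subseteq> V" using B C A by auto
  ultimately show "\<exists>A'\<in>{A. A \<subseteq> V \<and> card A = k}. A' \<inter> A = B" by blast
qed

lemma card_uniform_star_le:
  assumes V: "finite V" "a \<in> V"
    and F: "\<And>A. A \<in> F \<Longrightarrow> A \<subseteq> V \<and> card A = d + 1 \<and> a \<in> A"
  shows "card F \<le> (card V - 1) choose d"
proof -
  have "insert a (A - {a}) = A" if "A \<in> F" for A using F[OF that] by auto
  then have "inj_on (\<lambda>A. A - {a}) F" by (rule inj_on_inverseI)
  then have "card F = card ((\<lambda>A. A - {a}) ` F)" by (simp add: card_image)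
  also have "\<dots> \<le> card {B. B \<subseteq> V - {a} \<and> card B = d}"
  proof (rule card_mono)
    show "(\<lambda>A. A - {a}) ` F \<subseteq> {B. B \<subseteq> V - {a} \<and> card B = d}"
      using F by (fastforce simp: card_Diff_singleton)
  qed (use V in simp)
  also have "\<dots> = (card V - 1) choose d" using V by (simp add: n_subsets)
  finally show ?thesis .
qed

theorem theorem1p4:
  fixes n d :: nat and F :: "nat set set"
  assumes "d \<ge> 2" and "n \<ge> 2 * d + 2"
    and "F \<subseteq> {A. A \<subseteq> {1..n} \<and> card A = d + 1}"
    and "vc_dim {1..n} F \<le> enat d"
  shows "card F < n choose d"
proof (rule ccontr)
  assume large: "\<not> card F < n choose d"
  have unshattered: "\<not> shatters F A" if "A \<subseteq> {1..n}" "card A = d + 1" for A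
    using assms(4) that by (auto simp: vc_dim_le_iff)
  have missing: "\<exists>B. missing_trace F A B" if "A \<subseteq> {1..n}" "card A = d + 1" for A
    using unshattered[OF that] by (auto simp: shatters_def missing_trace_def)
  interpret large_unshattered_family "{1..n}" d F
  proof
    show "\<exists>B. missing_trace F A B" if "A \<in> F" for A
      using that missing[of A] assms(3) by blast
  qed (use assms large in auto)
  show False
  proof (cases "F = {A. A \<subseteq> {1..n} \<and> card A = d + 1}")
    case True
    have "{1..d+1} \<subseteq> {1..n}" "card {1..d+1} = d + 1" using assms by auto
    then show False
      using shatters_all_uniform[of "{1..n}" "d + 1" "{1..d+1}"] unshattered True assms(2) by auto
  next
    case False
    then obtain S where "S \<subseteq> {1..n}" "card S = d + 1" "S \<notin> F" using assms(3) by blast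
    then obtain a where "a \<in> {1..n}" "\<forall>A\<in>F. a \<in> A" using nonmember_imp_star by blast
    then have "card F \<le> (n - 1) choose d"
      using card_uniform_star_le[of "{1..n}" a F d] assms(3) by auto
    also have "\<dots> < n choose d"
    proof -
      have "n choose d = (n - 1 choose (d - 1)) + (n - 1 choose d)"
        using assms choose_reduce_nat[of n d] by simp
      moreover have "n - 1 choose (d - 1) > 0" using assms by simp
      ultimately show ?thesis by linarith
    qed
    finally show False using large by simp
  qed
qed

end
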